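(* For all integers $n\ge 1$ and $k\ge 0$, the over-Mahonian number $i_{B'}(n,k)$ equals the number of lattice paths in $\mathcal{P}^{B'}_{n,k}$, that is, $$i_{B'}(n,k)= |\mathcal{P}^{B'}_{n,k}|,$$ where $\mathcal{P}^{B'}_{n,k}$ is the set of lattice paths from $(0,0)$ to $(n-1,k)$ with North, East and North-East steps that take, at each level $j$, at most $j$ North steps if level $j$ is not entered by a diagonal (North-East) step, and at most $j-1$ North steps if level $j$ is entered by a diagonal step.
   Context: For $n\ge 1$, $B'_n$ denotes the set of overlined permutations of $\{1,\dots,n\}$ of the following kind: an element is a permutation $\sigma=\sigma_1\sigma_2\cdots\sigma_n$ of $\{1,\dots,n\}$ (in one-line notation) in which each entry $\sigma_i$ is independently either overlined or not overlined, subject to the condition that $\sigma_i$ may be overlined only if there is an index $j>i$ with $\sigma_i>\sigma_j$ (overlines are ignored in comparing entries). An inversion of such an element is a pair of positions $i<j$ with $\sigma_i>\sigma_j$, again ignoring overlines. The over-Mahonian number $i_{B'}(n,k)$ is the number of elements of $B'_n$ with exactly $k$ inversions; it is $0$ for integers $k$ outside $0\le k\le\binom n2$. Lattice paths: a North step is $(0,1)$, an East step is $(1,0)$, and a North-East (diagonal) step is $(1,1)$. Level $j$ ($0\le j\le n-1$) is the vertical line with abscissa $j$; the North steps at level $j$ are those taken on this line. Level $j\geq 1$ is entered by the unique East or North-East step going from abscissa $j-1$ to abscissa $j$. At level $0$ no North step is allowed. *)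

theory Defs
  imports "HOL-Combinatorics.Combinatorics" "HOL-Library.Product_Plus"
begin

(* An overlined permutation in one-line notation is a list of pairs (entry, flag);
   the flag says whether the entry is overlined.  Positions are counted from 0. *)
type_synonym overlined_word = "(nat \<times> bool) list"

definition inversions :: "overlined_word \<Rightarrow> (nat \<times> nat) set" where
  "inversions w = {(i, j). i < j \<and> j < length w \<and> fst (w ! i) > fst (w ! j)}"

definition B' :: "nat \<Rightarrow> overlined_word set" where
  "B' n = {w. map fst w \<in> permutations_of_set {1..n} \<and>
              (\<forall>i < length w. snd (w ! i) \<longrightarrow>
                 (\<exists>j. i < j \<and> j < length w \<and> fst (w ! i) > fst (w ! j)))}"

definition i_B' :: "nat \<Rightarrow> nat \<Rightarrow> nat" where
  "i_B' n k = card {w \<in> B' n. card (inversions w) = k}"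

datatype step = North | East | NorthEast

fun step_vector :: "step \<Rightarrow> nat \<times> nat" where
  "step_vector North = (0, 1)"
| "step_vector East = (1, 0)"
| "step_vector NorthEast = (1, 1)"

(* A lattice path starting at (0,0) is given by its list of steps;
   path_point p t is the point reached after the first t steps. *)
definition path_point :: "step list \<Rightarrow> nat \<Rightarrow> nat \<times> nat" where
  "path_point p t = sum_list (map step_vector (take t p))"

definition north_steps_at :: "step list \<Rightarrow> nat \<Rightarrow> nat" where
  "north_steps_at p j =
     card {t. t < length p \<and> p ! t = North \<and> fst (path_point p t) = j}"

definition entered_diagonally :: "step list \<Rightarrow> nat \<Rightarrow> bool" where
  "entered_diagonally p j \<longleftrightarrow>
     (\<exists>t < length p. p ! t = NorthEast \<and> fst (path_point p (Suc t)) = j)"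

(* Level 0 is never entered, so it falls under the first bound, which forbids
   North steps there; hence the truncated subtraction is only used for j >= 1. *)
definition paths_B' :: "nat \<Rightarrow> nat \<Rightarrow> step list set" where
  "paths_B' n k =
     {p. path_point p (length p) = (n - 1, k) \<and>
         (\<forall>j < n. north_steps_at p j \<le> (if entered_diagonally p j then j - 1 else j))}"

end

theory Submission
  imports Defs
begin

text \<open>
  Both families grow by the same choice. Let a \<^emph>\<open>digit\<close> for \<open>m\<close> be a pair \<open>(c, b)\<close> with
  \<open>c \<le> m\<close>, where the flag \<open>b\<close> may be set only if \<open>c > 0\<close>.

  An overlined permutation of \<open>{1..m + 1}\<close> arises in exactly one way from one of \<open>{1..m}\<close> by
  inserting the maximum \<open>m + 1\<close>, overlined according to \<open>b\<close>, so that \<open>c\<close> entries stand to its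
  right. This creates exactly \<open>c\<close> inversions. The maximum may be overlined iff \<open>c > 0\<close>, and since
  it is never smaller than another entry, it does not change which other entries may be overlined
  (\<open>bij_betw_insert_max\<close>).

  A lattice path ending on level \<open>m\<close> arises in exactly one way from one ending on level \<open>m - 1\<close> by
  entering level \<open>m\<close>, diagonally according to \<open>b\<close>, and then going North until the total rise on
  this level, including that of a diagonal entry, is \<open>c\<close>. A diagonal entry forces \<open>c > 0\<close> and
  lowers the allowed number of North steps by one, so that \<open>c \<le> m\<close> is the right bound in both cases
  (\<open>bij_betw_append_level\<close>).

  Hence inversions and final height increase by the same \<open>c\<close>, and induction on the size matches
  the two families by a bijection that turns the number of inversions into the final height.
\<close>

section \<open>Digits and matching of graded sets\<close>

definition digits :: "nat \<Rightarrow> (nat \<times> bool) set" where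
  "digits m = {(c, b). c \<le> m \<and> (b \<longrightarrow> c > 0)}"

text \<open>
  The induction step shared by both families, stated abstractly: if \<open>X\<close> is built from \<open>A\<close>, and \<open>Y\<close>
  from \<open>B\<close>, by adjoining an element of the same set \<open>D\<close> that contributes \<open>e\<close> to the grading on
  either side, then decomposing in \<open>X\<close>, transporting the first component along \<open>f\<close>, and
  recomposing in \<open>Y\<close> extends the matching.
\<close>

lemma grading_preserving_bij_extend:
  fixes s :: "'a \<Rightarrow> nat" and t :: "'b \<Rightarrow> nat"
  assumes f: "bij_betw f A B" and f_grade: "\<And>a. a \<in> A \<Longrightarrow> t (f a) = s a"
    and g: "bij_betw g (A \<times> D) X" and h: "bij_betw h (B \<times> D) Y"
    and g_grade: "\<And>a d. a \<in> A \<Longrightarrow> d \<in> D \<Longrightarrow> s' (g (a, d)) = s a + e d"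
    and h_grade: "\<And>b d. b \<in> B \<Longrightarrow> d \<in> D \<Longrightarrow> t' (h (b, d)) = t b + e d"
  shows "\<exists>f'. bij_betw f' X Y \<and> (\<forall>x\<in>X. t' (f' x) = s' x)"
proof (intro exI conjI ballI)
  let ?f' = "h \<circ> map_prod f id \<circ> inv_into (A \<times> D) g"
  have "bij_betw (map_prod f id) (A \<times> D) (B \<times> D)"
    using f by (intro bij_betw_map_prod) auto
  from bij_betw_trans[OF bij_betw_inv_into[OF g] bij_betw_trans[OF this h]]
  show "bij_betw ?f' X Y"
    by (simp add: comp_assoc)
  fix x assume "x \<in> X"
  then obtain a d where ad: "a \<in> A" "d \<in> D" "x = g (a, d)"
    using g by (auto simp: bij_betw_def)
  then have "inv_into (A \<times> D) g x = (a, d)"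
    using g by (auto simp: bij_betw_def)
  then show "t' (?f' x) = s' x"
    using ad f_grade g_grade h_grade bij_betwE[OF f] by simp
qed

section \<open>Overlined permutations: inserting the maximum\<close>

definition overlines_valid :: "overlined_word \<Rightarrow> bool" where
  "overlines_valid w \<longleftrightarrow>
     (\<forall>i < length w. snd (w ! i) \<longrightarrow> (\<exists>j. i < j \<and> j < length w \<and> fst (w ! i) > fst (w ! j)))"

lemma B'_iff: "w \<in> B' n \<longleftrightarrow> distinct (map fst w) \<and> fst ` set w = {1..n} \<and> overlines_valid w"
  by (auto simp: B'_def overlines_valid_def permutations_of_set_def)

lemma overlines_valid_Nil [simp]: "overlines_valid []"
  by (simp add: overlines_valid_def)

lemma overlines_valid_Cons [simp]:
  "overlines_valid (x # w) \<longleftrightarrow> (snd x \<longrightarrow> (\<exists>y\<in>set w. fst y < fst x)) \<and> overlines_valid w"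
proof -
  have front: "(\<exists>j. 0 < j \<and> j < Suc (length w) \<and> fst ((x # w) ! j) < fst x) \<longleftrightarrow>
      (\<exists>y\<in>set w. fst y < fst x)"
    by (fastforce simp: in_set_conv_nth gr0_conv_Suc)
  have tail: "(\<exists>j. Suc i < j \<and> j < Suc (length w) \<and> fst ((x # w) ! j) < fst (w ! i)) \<longleftrightarrow>
      (\<exists>j. i < j \<and> j < length w \<and> fst (w ! j) < fst (w ! i))" for i
  proof -
    have "(\<exists>j. Suc i < j \<and> P j) \<longleftrightarrow> (\<exists>j. i < j \<and> P (Suc j))" for P
      using Suc_less_eq2 by auto
    from this[of "\<lambda>j. j < Suc (length w) \<and> fst ((x # w) ! j) < fst (w ! i)"]
    show ?thesis by simp
  qed
  show ?thesis
    unfolding overlines_valid_def by (simp add: All_less_Suc2 front tail)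
qed

text \<open>
  Inserting \<open>x\<close> gives the entries before it no new smaller entry and leaves the part after it
  unchanged, so no other entry starts or ceases to be allowed an overline. For \<open>x\<close> itself every
  later entry is smaller.
\<close>

lemma overlines_valid_insert_greater:
  assumes "\<And>y. y \<in> set (u @ v) \<Longrightarrow> fst y < fst x"
  shows "overlines_valid (u @ x # v) \<longleftrightarrow> overlines_valid (u @ v) \<and> (snd x \<longrightarrow> v \<noteq> [])"
  using assms
proof (induction u)
  case Nil
  then show ?case by (cases v) auto
next
  case (Cons a u)
  have "\<not> fst x < fst a"
    using Cons.prems[of a] by simp
  moreover have "overlines_valid (u @ x # v) \<longleftrightarrow> overlines_valid (u @ v) \<and> (snd x \<longrightarrow> v \<noteq> [])"
    using Cons by simp
  ultimately show ?case
    by auto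
qed

lemma finite_inversions [simp]: "finite (inversions w)"
  by (rule finite_subset[of _ "{..<length w} \<times> {..<length w}"]) (auto simp: inversions_def)

lemma card_inversions_Nil [simp]: "card (inversions []) = 0"
  by (simp add: inversions_def)

text \<open>
  Peeling off the first entry turns the set of index pairs into a count that recurses along the list:
  the first entry forms the pairs with index \<open>0\<close>, and all other indices are shifted by one.
\<close>

lemma card_inversions_Cons [simp]:
  "card (inversions (x # w)) = length (filter (\<lambda>y. fst y < fst x) w) + card (inversions w)"
proof -
  let ?J = "{j. j < length w \<and> fst (w ! j) < fst x}"
  have split: "inversions (x # w) = (\<lambda>j. (0, Suc j)) ` ?J \<union> map_prod Suc Suc ` inversions w"
    (is "?L = ?R")
  proof
    show "?L \<subseteq> ?R"
    proof
      fix ij assume "ij \<in> ?L"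
      then obtain i j where ij: "ij = (i, Suc j)" "i < Suc j" "j < length w"
          "fst (w ! j) < fst ((x # w) ! i)"
        by (cases ij; cases "snd ij") (auto simp: inversions_def)
      show "ij \<in> ?R"
      proof (cases i)
        case 0
        then show ?thesis
          using ij by auto
      next
        case (Suc i')
        then have "(i', j) \<in> inversions w" "ij = map_prod Suc Suc (i', j)"
          using ij by (auto simp: inversions_def)
        then have "ij \<in> map_prod Suc Suc ` inversions w"
          by (metis imageI)
        then show ?thesis
          by (rule UnI2)
      qed
    qed
  qed (auto simp: inversions_def)
  have "card ?L = card ((\<lambda>j. (0::nat, Suc j)) ` ?J) + card (map_prod Suc Suc ` inversions w)"
    unfolding split by (rule card_Un_disjoint) auto
  also have "\<dots> = card ?J + card (inversions w)"
    by (auto intro!: arg_cong2[of _ _ _ _ "(+)"] card_image simp: inj_on_def)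
  finally show ?thesis
    by (simp add: length_filter_conv_card)
qed

text \<open>A largest entry forms an inversion with exactly the entries to its right.\<close>

lemma card_inversions_insert_greater:
  assumes "\<And>y. y \<in> set (u @ v) \<Longrightarrow> fst y < fst x"
  shows "card (inversions (u @ x # v)) = card (inversions (u @ v)) + length v"
  using assms
proof (induction u)
  case Nil
  then have "filter (\<lambda>y. fst y < fst x) v = v"
    by (simp add: filter_id_conv)
  then show ?case by simp
next
  case (Cons a u)
  have "\<not> fst x < fst a"
    using Cons.prems[of a] by simp
  moreover have "card (inversions (u @ x # v)) = card (inversions (u @ v)) + length v"
    using Cons by simp
  ultimately show ?case
    by simp
qed

definition insert_max :: "nat \<Rightarrow> overlined_word \<times> nat \<times> bool \<Rightarrow> overlined_word" where
  "insert_max m = (\<lambda>(w, c, b). take (m - c) w @ (Suc m, b) # drop (m - c) w)"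

lemma B'_length: "w \<in> B' n \<Longrightarrow> length w = n"
  using distinct_card[of "map fst w"] by (simp add: B'_iff)

lemma B'_fst_le: "w \<in> B' n \<Longrightarrow> y \<in> set w \<Longrightarrow> fst y \<le> n"
  by (auto simp: B'_iff)

lemma B'_Suc_iff:
  assumes "fst x = Suc m"
  shows "u @ x # v \<in> B' (Suc m) \<longleftrightarrow> u @ v \<in> B' m \<and> (snd x \<longrightarrow> v \<noteq> [])"
proof -
  have "distinct (map fst (u @ x # v)) \<and> fst ` set (u @ x # v) = {1..Suc m} \<longleftrightarrow>
      distinct (map fst (u @ v)) \<and> Suc m \<notin> fst ` set (u @ v) \<and>
      insert (Suc m) (fst ` set (u @ v)) = {1..Suc m}"
    using assms by auto
  also have "\<dots> \<longleftrightarrow> distinct (map fst (u @ v)) \<and> fst ` set (u @ v) = {1..m}"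
  proof -
    have "Suc m \<notin> S \<and> insert (Suc m) S = {1..Suc m} \<longleftrightarrow> S = {1..m}" for S
    proof -
      have "{1..Suc m} = insert (Suc m) {1..m}" "Suc m \<notin> {1..m}"
        by auto
      then show ?thesis
        by (metis insert_ident)
    qed
    then show ?thesis
      by simp
  qed
  finally have perm: "distinct (map fst (u @ x # v)) \<and> fst ` set (u @ x # v) = {1..Suc m} \<longleftrightarrow>
      distinct (map fst (u @ v)) \<and> fst ` set (u @ v) = {1..m}" .
  have "fst y < fst x" if "fst ` set (u @ v) = {1..m}" "y \<in> set (u @ v)" for y
  proof -
    have "fst y \<in> {1..m}"
      using that by (metis imageI)
    then show ?thesis
      using assms by simp
  qed
  then show ?thesis
    using perm overlines_valid_insert_greater[of u v x] unfolding B'_iff by blast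
qed

text \<open>
  The decomposition is recovered from the position of the unique entry \<open>m + 1\<close>: the prefix before it
  and the suffix after it give back the shorter word, and the length of the suffix is \<open>c\<close>.
\<close>

lemma bij_betw_insert_max: "bij_betw (insert_max m) (B' m \<times> digits m) (B' (Suc m))"
  unfolding bij_betw_def
proof
  show "inj_on (insert_max m) (B' m \<times> digits m)"
  proof (rule inj_onI, clarify)
    fix w c b w' c' b'
    assume w: "w \<in> B' m" "(c, b) \<in> digits m" and w': "w' \<in> B' m" "(c', b') \<in> digits m"
      and eq: "insert_max m (w, c, b) = insert_max m (w', c', b')"
    have "takeWhile (\<lambda>y. fst y \<noteq> Suc m) (insert_max m (w, c, b)) = take (m - c) w"
      if "w \<in> B' m" for w c b
    proof -
      have "fst y \<noteq> Suc m" if "y \<in> set (take (m - c) w)" for y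
        using B'_fst_le[OF \<open>w \<in> B' m\<close> in_set_takeD[OF that]] by simp
      then show ?thesis
        by (simp add: insert_max_def)
    qed
    then have pre: "take (m - c) w = take (m - c') w'"
      using w w' eq by metis
    then have post: "(Suc m, b) # drop (m - c) w = (Suc m, b') # drop (m - c') w'"
      using eq by (simp add: insert_max_def)
    have "length (drop (m - c) w) = c" "length (drop (m - c') w') = c'"
      using w w' by (auto simp: B'_length digits_def)
    then have "c = c'"
      using post by (metis list.inject)
    moreover have "w = w'"
      using pre post by (metis append_take_drop_id list.inject)
    ultimately show "w = w' \<and> (c, b) = (c', b')"
      using post by simp
  qed
next
  show "insert_max m ` (B' m \<times> digits m) = B' (Suc m)"
  proof (intro equalityI subsetI)
    fix w assume "w \<in> insert_max m ` (B' m \<times> digits m)"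
    then show "w \<in> B' (Suc m)"
      by (auto simp: insert_max_def B'_Suc_iff digits_def) (use B'_length in force)
  next
    fix w assume w: "w \<in> B' (Suc m)"
    then have "Suc m \<in> fst ` set w"
      by (auto simp: B'_iff)
    then obtain u b v where uv: "w = u @ (Suc m, b) # v"
      by (metis imageE prod.collapse split_list)
    then have rest: "u @ v \<in> B' m" "b \<longrightarrow> v \<noteq> []"
      using w by (auto simp: B'_Suc_iff)
    then have len: "length u + length v = m"
      by (auto dest: B'_length)
    then have "w = insert_max m (u @ v, length v, b)"
      using uv by (auto simp: insert_max_def)
    moreover have "(length v, b) \<in> digits m"
      using rest len by (auto simp: digits_def)
    ultimately show "w \<in> insert_max m ` (B' m \<times> digits m)"
      using rest by blast
  qed
qed

lemma card_inversions_insert_max: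
  assumes "w \<in> B' m" "d \<in> digits m"
  shows "card (inversions (insert_max m (w, d))) = card (inversions w) + fst d"
proof -
  obtain c b where d: "d = (c, b)" "c \<le> m"
    using assms by (auto simp: digits_def)
  have "fst y < fst (Suc m, b)" if "y \<in> set (take (m - c) w @ drop (m - c) w)" for y
    using B'_fst_le[OF assms(1)] that by (fastforce simp: less_Suc_eq_le)
  from card_inversions_insert_greater[of "take (m - c) w" "drop (m - c) w" "(Suc m, b)", OF this]
  show ?thesis
    using d B'_length[OF assms(1)] by (simp add: insert_max_def)
qed

section \<open>Lattice paths: appending a level\<close>

definition path_end :: "step list \<Rightarrow> nat \<times> nat" where
  "path_end p = path_point p (length p)"

lemma path_end_append: "path_end (p @ q) = path_end p + path_end q"
  by (simp add: path_end_def path_point_def)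

lemma path_end_Nil [simp]: "path_end [] = 0"
  by (simp add: path_end_def path_point_def)

lemma path_end_Cons [simp]: "path_end (s # p) = step_vector s + path_end p"
  by (simp add: path_end_def path_point_def)

lemma path_end_replicate_North [simp]: "path_end (replicate c North) = (0, c)"
  by (induction c) (simp_all add: prod_eq_iff)

lemma path_point_append: "t \<le> length p \<Longrightarrow> path_point (p @ q) t = path_point p t"
  by (simp add: path_point_def)

lemma north_steps_at_snoc:
  "north_steps_at (p @ [s]) j =
     north_steps_at p j + (if s = North \<and> fst (path_end p) = j then 1 else 0)"
proof -
  let ?S = "\<lambda>p. {t. t < length p \<and> p ! t = North \<and> fst (path_point p t) = j}"
  have "?S (p @ [s]) = ?S p \<union> (if s = North \<and> fst (path_end p) = j then {length p} else {})"
    by (auto simp: nth_append path_point_append path_end_def less_Suc_eq split: if_splits)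
  then show ?thesis
    by (simp add: north_steps_at_def)
qed

lemma entered_diagonally_snoc:
  "entered_diagonally (p @ [s]) j \<longleftrightarrow>
     entered_diagonally p j \<or> s = NorthEast \<and> Suc (fst (path_end p)) = j"
proof -
  have last: "path_point (p @ [s]) (Suc (length p)) = path_end p + step_vector s"
    by (simp add: path_end_def path_point_def)
  have "entered_diagonally (p @ [s]) j \<longleftrightarrow>
      (\<exists>t<length p. p ! t = NorthEast \<and> fst (path_point (p @ [s]) (Suc t)) = j) \<or>
      s = NorthEast \<and> fst (path_end p + step_vector s) = j"
    by (auto simp: entered_diagonally_def Ex_less_Suc nth_append last)
  also have "(\<exists>t<length p. p ! t = NorthEast \<and> fst (path_point (p @ [s]) (Suc t)) = j) \<longleftrightarrow>
      entered_diagonally p j"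
    by (auto simp: entered_diagonally_def path_point_append)
  finally show ?thesis
    by auto
qed

lemma north_steps_at_append_Norths:
  "north_steps_at (p @ replicate c North) j =
     north_steps_at p j + (if fst (path_end p) = j then c else 0)"
proof (induction c)
  case (Suc c)
  then show ?case
    using north_steps_at_snoc[of "p @ replicate c North" North j]
    by (simp add: path_end_append replicate_append_same)
qed simp

lemma entered_diagonally_append_Norths:
  "entered_diagonally (p @ replicate c North) j \<longleftrightarrow> entered_diagonally p j"
proof (induction c)
  case (Suc c)
  then show ?case
    using entered_diagonally_snoc[of "p @ replicate c North" North j]
    by (simp add: replicate_append_same)
qed simp

lemma nothing_beyond_path_end:
  assumes "fst (path_end p) < j"
  shows "north_steps_at p j = 0 \<and> \<not> entered_diagonally p j"
  using assms
proof (induction p rule: rev_induct)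
  case Nil
  then show ?case
    by (simp add: north_steps_at_def entered_diagonally_def)
next
  case (snoc s p)
  then show ?case
    by (cases s) (auto simp: north_steps_at_snoc entered_diagonally_snoc path_end_append)
qed

definition level_ok :: "step list \<Rightarrow> nat \<Rightarrow> bool" where
  "level_ok p j \<longleftrightarrow> north_steps_at p j \<le> (if entered_diagonally p j then j - 1 else j)"

definition paths_to_level :: "nat \<Rightarrow> step list set" where
  "paths_to_level m = {p. fst (path_end p) = m \<and> (\<forall>j\<le>m. level_ok p j)}"

lemma paths_B'_eq: "paths_B' (Suc m) k = {p \<in> paths_to_level m. snd (path_end p) = k}"
  by (auto simp: paths_B'_def paths_to_level_def level_ok_def path_end_def less_Suc_eq_le)

text \<open>
  The number \<open>c\<close> is the height gained on the new level, not the number of its North steps: a diagonal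
  entry already contributes one unit, which is why one North step fewer follows it.
\<close>

definition level_steps :: "nat \<times> bool \<Rightarrow> step list" where
  "level_steps = (\<lambda>(c, b). if b then NorthEast # replicate (c - 1) North
                           else East # replicate c North)"

definition append_level :: "step list \<times> nat \<times> bool \<Rightarrow> step list" where
  "append_level = (\<lambda>(p, d). p @ level_steps d)"

lemma path_end_append_level:
  "d \<in> digits m \<Longrightarrow> path_end (append_level (p, d)) = path_end p + (1, fst d)"
  by (auto simp: append_level_def level_steps_def path_end_append digits_def)

text \<open>
  The run of North steps after the last step of another kind is determined by the path, namely as the
  longest all-North prefix of the reversed path.
\<close>

lemma append_nonNorth_Norths_eq_iff:
  assumes "s \<noteq> North" "s' \<noteq> North"
  shows "p @ s # replicate c North = p' @ s' # replicate c' North \<longleftrightarrow> p = p' \<and> s = s' \<and> c = c'"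
proof
  assume eq: "p @ s # replicate c North = p' @ s' # replicate c' North"
  have "takeWhile (\<lambda>x. x = North) (rev (p @ s # replicate c North)) = replicate c North"
    if "s \<noteq> North" for p s c
    using that by (simp add: takeWhile_append)
  then have "replicate c North = replicate c' North"
    using assms eq by metis
  then show "p = p' \<and> s = s' \<and> c = c'"
    using eq by simp
qed simp

text \<open>
  A path that has reached level \<open>m\<close> has no steps beyond it, so on level \<open>m + 1\<close> the extended path
  has precisely the added steps, while the counts on the levels up to \<open>m\<close> stay the same.
\<close>

lemma append_level_in_paths_iff:
  assumes "s \<noteq> North"
  shows "p @ s # replicate c North \<in> paths_to_level (Suc m) \<longleftrightarrow>
     p \<in> paths_to_level m \<and> c \<le> (if s = NorthEast then m else Suc m)"
proof -
  let ?q = "p @ s # replicate c North"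
  have end_eq: "fst (path_end ?q) = Suc (fst (path_end p))"
    using assms by (cases s) (auto simp: path_end_append)
  have norths: "north_steps_at ?q j =
      north_steps_at p j + (if Suc (fst (path_end p)) = j then c else 0)" for j
    using assms north_steps_at_append_Norths[of "p @ [s]" c j]
    by (cases s) (auto simp: north_steps_at_snoc path_end_append)
  have diag: "entered_diagonally ?q j \<longleftrightarrow>
      entered_diagonally p j \<or> s = NorthEast \<and> Suc (fst (path_end p)) = j" for j
    using entered_diagonally_append_Norths[of "p @ [s]" c j]
    by (simp add: entered_diagonally_snoc)
  have old: "level_ok ?q j \<longleftrightarrow> level_ok p j" if "fst (path_end p) = m" "j \<le> m" for j
    using that by (auto simp: level_ok_def norths diag)
  have new: "level_ok ?q (Suc m) \<longleftrightarrow> c \<le> (if s = NorthEast then m else Suc m)"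
    if "fst (path_end p) = m"
    using that nothing_beyond_path_end[of p "Suc m"] by (simp add: level_ok_def norths diag)
  have "?q \<in> paths_to_level (Suc m) \<longleftrightarrow> fst (path_end p) = m \<and>
      (\<forall>j\<le>m. level_ok ?q j) \<and> level_ok ?q (Suc m)"
    by (auto simp: paths_to_level_def end_eq le_Suc_eq)
  then show ?thesis
    using old new by (auto simp: paths_to_level_def)
qed

text \<open>
  Cutting a path just before its last step that is not North inverts the construction; such a step
  exists because the path reaches a positive level.
\<close>

lemma bij_betw_append_level:
  "bij_betw append_level (paths_to_level m \<times> digits (Suc m)) (paths_to_level (Suc m))"
  unfolding bij_betw_def
proof
  show "inj_on append_level (paths_to_level m \<times> digits (Suc m))"
    by (auto simp: inj_on_def append_level_def level_steps_def digits_def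
        append_nonNorth_Norths_eq_iff split: if_splits)
next
  show "append_level ` (paths_to_level m \<times> digits (Suc m)) = paths_to_level (Suc m)"
  proof (intro equalityI subsetI)
    fix q assume "q \<in> append_level ` (paths_to_level m \<times> digits (Suc m))"
    then show "q \<in> paths_to_level (Suc m)"
      by (auto simp: append_level_def level_steps_def digits_def append_level_in_paths_iff)
  next
    fix q assume q: "q \<in> paths_to_level (Suc m)"
    \<comment> \<open>A path of North steps only stays on level 0.\<close>
    have "\<exists>s\<in>set q. s \<noteq> North"
    proof (rule ccontr)
      assume "\<not> (\<exists>s\<in>set q. s \<noteq> North)"
      then have "q = replicate (length q) North"
        by (simp add: replicate_length_same)
      then have "fst (path_end q) = 0"
        by (metis fst_conv path_end_replicate_North)
      then show False
        using q by (simp add: paths_to_level_def)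
    qed
    from split_list_last_prop[OF this]
    obtain p s zs where split: "q = p @ s # zs" "s \<noteq> North" "\<forall>z\<in>set zs. z = North"
      by blast
    define c where "c = length zs"
    have q_eq: "q = p @ s # replicate c North"
      using split by (simp add: c_def replicate_length_same)
    then have p: "p \<in> paths_to_level m" and c: "c \<le> (if s = NorthEast then m else Suc m)"
      using q split(2) append_level_in_paths_iff by auto
    \<comment> \<open>The diagonal entry is counted in the digit.\<close>
    let ?d = "if s = NorthEast then (Suc c, True) else (c, False)"
    have "?d \<in> digits (Suc m)"
      using c by (cases "s = NorthEast") (auto simp: digits_def)
    moreover have "q = append_level (p, ?d)"
      using q_eq split(2) by (cases s) (simp_all add: append_level_def level_steps_def)
    ultimately show "q \<in> append_level ` (paths_to_level m \<times> digits (Suc m))"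
      using p by blast
  qed
qed

section \<open>Matching permutations with paths\<close>

text \<open>
  The sizes are offset by one because level \<open>0\<close> corresponds to the entry \<open>1\<close>: neither leaves a choice,
  as \<open>digits 0\<close> is a singleton and no North step is allowed on level \<open>0\<close>.
\<close>

lemma ex_bij_permutations_paths:
  "\<exists>f. bij_betw f (B' (Suc m)) (paths_to_level m) \<and>
       (\<forall>w\<in>B' (Suc m). snd (path_end (f w)) = card (inversions w))"
proof (induction m)
  case 0
  have "B' 0 = {[]}"
    by (auto simp: B'_iff)
  moreover have "digits 0 = {(0, False)}"
    by (auto simp: digits_def)
  moreover have "B' (Suc 0) = insert_max 0 ` (B' 0 \<times> digits 0)"
    using bij_betw_insert_max by (simp add: bij_betw_def)
  ultimately have words: "B' (Suc 0) = {[(1, False)]}"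
    by (simp add: insert_max_def)
  have "p = []" if "fst (path_end p) = 0" "level_ok p 0" for p
    using that
  proof (induction p rule: rev_induct)
    case (snoc s p)
    then show ?case
      by (cases s) (auto simp: level_ok_def north_steps_at_snoc path_end_append split: if_splits)
  qed simp
  then have paths: "paths_to_level 0 = {[]}"
    by (auto simp: paths_to_level_def level_ok_def north_steps_at_def)
  show ?case
    unfolding words paths by (intro exI[of _ "\<lambda>_. []"]) simp
next
  case (Suc m)
  then obtain f where f: "bij_betw f (B' (Suc m)) (paths_to_level m)"
    "\<And>w. w \<in> B' (Suc m) \<Longrightarrow> snd (path_end (f w)) = card (inversions w)"
    by blast
  show ?case
    by (rule grading_preserving_bij_extend
          [where s = "\<lambda>w. card (inversions w)" and t = "\<lambda>p. snd (path_end p)" and e = fst,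
            OF f bij_betw_insert_max bij_betw_append_level card_inversions_insert_max])
      (simp_all add: path_end_append_level)
qed

theorem theorem3p1:
  fixes n k :: nat
  assumes "n \<ge> 1"
  shows "i_B' n k = card (paths_B' n k)"
proof -
  obtain m where n: "n = Suc m"
    using assms by (cases n) auto
  obtain f where f: "bij_betw f (B' n) (paths_to_level m)"
    "\<And>w. w \<in> B' n \<Longrightarrow> snd (path_end (f w)) = card (inversions w)"
    using ex_bij_permutations_paths n by blast
  have "paths_B' n k = {p \<in> f ` B' n. snd (path_end p) = k}"
    using f(1) by (simp add: n paths_B'_eq bij_betw_def)
  also have "\<dots> = f ` {w \<in> B' n. card (inversions w) = k}"
    by (auto simp: f(2))
  finally have "bij_betw f {w \<in> B' n. card (inversions w) = k} (paths_B' n k)"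
    using f(1) by (auto intro: bij_betw_subset)
  then show ?thesis
    unfolding i_B'_def by (rule bij_betw_same_card)
qed

end
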